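(* For any $t\in\mathbb{Z}^+$, $\mathrm{PAG}_t\in\mathcal{C}_t^{(\mu_0,\mu_1)}$.
   Context: Error measures: for an instance with true bits $x\in\{0,1\}^n$ and predictions $\hat x\in\{0,1\}^n$, $\mu_0=\sum_i x_i(1-\hat x_i)$ and $\mu_1=\sum_i(1-x_i)\hat x_i$. A deterministic online algorithm for a minimization problem is $(\alpha,\beta,\gamma)$-competitive w.r.t. $(\mu_0,\mu_1)$ if there is a constant $\kappa$ with $\mathrm{Alg}(I)\le\alpha\,\mathrm{Opt}(I)+\beta\,\mu_0(I)+\gamma\,\mu_1(I)+\kappa$ for all instances $I$. $Q$ is as hard as $P$ if existence of an $(\alpha,\beta,\gamma)$-competitive algorithm for $Q$ w.r.t. $(\mu_0,\mu_1)$ implies existence of one for $P$ w.r.t. $(\mu_0,\mu_1)$. $P\in\mathcal{C}_t^{(\mu_0,\mu_1)}$ if $\mathrm{ASG}_t$ is as hard as $P$. $\mathrm{ASG}_t$: instance $(x,\hat x,r)$; each request $r_i$ prompts an output bit $y_i$, with $\hat x_i$ revealed together with $r_i$; $x$ is revealed after the last request; cost $\sum_i(y_i+t\,x_i(1-y_i))$. Paging with Discard Predictions $\mathrm{PAG}_t$: a universe $U$ of $N>t$ pages and a cache holding $t$ pages, initially empty. An instance is $(x,\hat x,r)$ where $r=\langle r_1,\dots,r_n\rangle$ is a sequence of pages; when $r_i$ is requested (together with the prediction bit $\hat x_i$) and the page is not in cache (a fault), the algorithm must bring it into cache, evicting a page of its choice if the cache is full. Cost = number of faults. $\mathrm{LFD}$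 is the optimal offline algorithm that fills the cache and on a fault with full cache evicts the page whose next request is furthest in the future. $x_i=0$ if $\mathrm{LFD}$ keeps the page of $r_i$ in cache until it is next requested (or, if it is never requested again, until the end), and $x_i=1$ otherwise; $\hat x_i$ predicts $x_i$. *)

theory Defs
  imports Complex_Main "HOL-Library.Extended_Nat"
begin

text \<open>An instance is a triple \<open>(x, xh, r)\<close> of true bits, predicted bits and requests;
  \<open>True\<close> encodes the bit 1.\<close>

type_synonym 'r inst = "bool list \<times> bool list \<times> 'r list"

definition mu0 :: "'r inst \<Rightarrow> real" where
  "mu0 = (\<lambda>(x, xh, r). \<Sum>i<length r. of_bool (x ! i) * (1 - of_bool (xh ! i)))"

definition mu1 :: "'r inst \<Rightarrow> real" where
  "mu1 = (\<lambda>(x, xh, r). \<Sum>i<length r. (1 - of_bool (x ! i)) * of_bool (xh ! i))"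

text \<open>A minimization problem; \<open>feasible I ys\<close> says that \<open>ys\<close> is an admissible sequence of
  answers to the requests of \<open>I\<close>.\<close>

record ('r, 'a) online_problem =
  instances :: "'r inst set"
  feasible :: "'r inst \<Rightarrow> 'a list \<Rightarrow> bool"
  cost :: "'r inst \<Rightarrow> 'a list \<Rightarrow> real"

definition Opt :: "('r, 'a) online_problem \<Rightarrow> 'r inst \<Rightarrow> real" where
  "Opt P I = Inf {cost P I ys | ys. feasible P I ys}"

text \<open>A deterministic online algorithm maps the requests and predictions seen so far, the
  current ones included, to its answer to the current request.\<close>

type_synonym ('r, 'a) online_alg = "('r \<times> bool) list \<Rightarrow> 'a"

definition answers :: "('r, 'a) online_alg \<Rightarrow> 'r inst \<Rightarrow> 'a list" where
  "answers A = (\<lambda>(x, xh, r). map (\<lambda>i. A (take (Suc i) (zip r xh))) [0..<length r])"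

definition competitive ::
  "('r, 'a) online_problem \<Rightarrow> real \<Rightarrow> real \<Rightarrow> real \<Rightarrow> ('r, 'a) online_alg \<Rightarrow> bool" where
  "competitive P \<alpha> \<beta> \<gamma> A \<longleftrightarrow>
     (\<forall>I\<in>instances P. feasible P I (answers A I)) \<and>
     (\<exists>\<kappa>. \<forall>I\<in>instances P.
        cost P I (answers A I) \<le> \<alpha> * Opt P I + \<beta> * mu0 I + \<gamma> * mu1 I + \<kappa>)"

definition as_hard_as :: "('r, 'a) online_problem \<Rightarrow> ('s, 'b) online_problem \<Rightarrow> bool" where
  "as_hard_as Q P \<longleftrightarrow>
     (\<forall>\<alpha> \<beta> \<gamma>. (\<exists>A. competitive Q \<alpha> \<beta> \<gamma> A) \<longrightarrow> (\<exists>B. competitive P \<alpha> \<beta> \<gamma> B))"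

text \<open>The requests of \<open>ASG\<close> are mere prompts, hence of type \<^typ>\<open>unit\<close>.\<close>

definition ASG :: "nat \<Rightarrow> (unit, bool) online_problem" where
  "ASG t =
    \<lparr>instances = {(x, xh, r). length x = length r \<and> length xh = length r},
     feasible = (\<lambda>(x, xh, r) y. length y = length r),
     cost = (\<lambda>(x, xh, r) y.
       \<Sum>i<length r. of_bool (y ! i) + real t * of_bool (x ! i) * (1 - of_bool (y ! i)))\<rparr>"

definition complexity_class :: "nat \<Rightarrow> ('r, 'a) online_problem set" where
  "complexity_class t = {P. as_hard_as (ASG t) P}"

text \<open>Paging. The answer to a request is \<open>Some q\<close> if page \<open>q\<close> is evicted and \<open>None\<close> if nothing
  is evicted; \<open>cache r a i\<close> is the cache content just before request \<open>i\<close> (counted from 0).\<close>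

primrec cache :: "'p list \<Rightarrow> 'p option list \<Rightarrow> nat \<Rightarrow> 'p set" where
  "cache r a 0 = {}"
| "cache r a (Suc i) = insert (r ! i) (cache r a i - set_option (a ! i))"

definition legal_answer :: "nat \<Rightarrow> 'p set \<Rightarrow> 'p \<Rightarrow> 'p option \<Rightarrow> bool" where
  "legal_answer t C p e \<longleftrightarrow>
     (if p \<notin> C \<and> card C \<ge> t then \<exists>q\<in>C. e = Some q else e = None)"

definition paging_run :: "nat \<Rightarrow> 'p list \<Rightarrow> 'p option list \<Rightarrow> bool" where
  "paging_run t r a \<longleftrightarrow>
     length a = length r \<and> (\<forall>i<length r. legal_answer t (cache r a i) (r ! i) (a ! i))"

definition faults :: "'p list \<Rightarrow> 'p option list \<Rightarrow> nat" where
  "faults r a = card {i. i < length r \<and> r ! i \<notin> cache r a i}"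

text \<open>The position of the next request to \<open>p\<close> after request \<open>i\<close>; it is \<open>\<infinity>\<close>, the infimum of the
  empty set, if there is none.\<close>

definition next_request :: "'p list \<Rightarrow> nat \<Rightarrow> 'p \<Rightarrow> enat" where
  "next_request r i p = Inf {enat k | k. i < k \<and> k < length r \<and> r ! k = p}"

definition LFD_run :: "nat \<Rightarrow> 'p list \<Rightarrow> 'p option list \<Rightarrow> bool" where
  "LFD_run t r a \<longleftrightarrow>
     paging_run t r a \<and>
     (\<forall>i<length r. \<forall>q. a ! i = Some q \<longrightarrow>
        (\<forall>p\<in>cache r a i. next_request r i p \<le> next_request r i q))"

text \<open>Several cached pages may never be requested again, so the LFD rule leaves ties; \<open>is_LFD\<close>
  admits every way of breaking them.\<close>

definition is_LFD :: "nat \<Rightarrow> 'p set \<Rightarrow> ('p list \<Rightarrow> 'p option list) \<Rightarrow> bool" where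
  "is_LFD t U lfd \<longleftrightarrow> (\<forall>r. set r \<subseteq> U \<longrightarrow> LFD_run t r (lfd r))"

text \<open>The premise on \<open>l\<close> restricts \<open>m\<close> to the times up to the next request to the page \<open>r ! i\<close>,
  or up to the end if there is none.\<close>

definition kept :: "'p list \<Rightarrow> 'p option list \<Rightarrow> nat \<Rightarrow> bool" where
  "kept r a i \<longleftrightarrow>
     (\<forall>m. i < m \<and> m \<le> length r \<and> (\<forall>l. i < l \<and> l < m \<longrightarrow> r ! l \<noteq> r ! i)
        \<longrightarrow> r ! i \<in> cache r a m)"

definition discard_bits :: "'p list \<Rightarrow> 'p option list \<Rightarrow> bool list" where
  "discard_bits r a = map (\<lambda>i. \<not> kept r a i) [0..<length r]"

definition PAG ::
  "nat \<Rightarrow> 'p set \<Rightarrow> ('p list \<Rightarrow> 'p option list) \<Rightarrow> ('p, 'p option) online_problem" where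
  "PAG t U lfd =
    \<lparr>instances = {(x, xh, r). set r \<subseteq> U \<and> length xh = length r \<and> x = discard_bits r (lfd r)},
     feasible = (\<lambda>(x, xh, r) a. paging_run t r a),
     cost = (\<lambda>(x, xh, r) a. real (faults r a))\<rparr>"

lemma cache_append: "i \<le> length a \<Longrightarrow> cache r (a @ b) i = cache r a i"
  by (induction i) (auto simp: nth_append)

lemma LFD_run_exists:
  assumes "t > 0"
  shows "\<exists>a. LFD_run t r a"
proof -
  let ?P = "\<lambda>a i. legal_answer t (cache r a i) (r ! i) (a ! i) \<and>
    (\<forall>q. a ! i = Some q \<longrightarrow> (\<forall>p\<in>cache r a i. next_request r i p \<le> next_request r i q))"
  have "\<exists>a. length a = m \<and> (\<forall>i<m. ?P a i)" for m
  proof (induction m)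
    case 0
    then show ?case by simp
  next
    case (Suc m)
    then obtain a where a: "length a = m" "\<forall>i<m. ?P a i" by blast
    define C where "C = cache r a m"
    have "\<exists>e. legal_answer t C (r ! m) e \<and>
        (\<forall>q. e = Some q \<longrightarrow> (\<forall>p\<in>C. next_request r m p \<le> next_request r m q))"
    proof (cases "r ! m \<notin> C \<and> card C \<ge> t")
      case True
      with assms have C: "finite C" "C \<noteq> {}"
        by (auto intro: card_ge_0_finite)
      then have "Max (next_request r m ` C) \<in> next_request r m ` C"
        by (intro Max_in) auto
      then obtain q where "q \<in> C" "next_request r m q = Max (next_request r m ` C)"
        by auto
      with C True show ?thesis
        by (intro exI[of _ "Some q"]) (auto simp: legal_answer_def)
    next
      case False
      then show ?thesis by (intro exI[of _ None]) (auto simp: legal_answer_def)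
    qed
    then obtain e where e: "legal_answer t C (r ! m) e"
      "\<forall>q. e = Some q \<longrightarrow> (\<forall>p\<in>C. next_request r m p \<le> next_request r m q)" by blast
    have "?P (a @ [e]) i" if "i < Suc m" for i
    proof (cases "i = m")
      case True
      with a(1) e show ?thesis by (simp add: cache_append C_def nth_append)
    next
      case False
      with that have "i < m" by simp
      with a show ?thesis by (simp add: cache_append nth_append)
    qed
    with a(1) show ?case by (intro exI[of _ "a @ [e]"]) simp
  qed
  from this[of "length r"] show ?thesis
    by (auto simp: LFD_run_def paging_run_def)
qed

lemma is_LFD_exists: "t > 0 \<Longrightarrow> \<exists>lfd. is_LFD t U lfd"
  unfolding is_LFD_def by (rule exI[of _ "\<lambda>r. SOME a. LFD_run t r a"])
    (auto intro: someI_ex LFD_run_exists)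

end

theory Submission
  imports Defs
begin

text \<open>Given an algorithm for \<open>ASG\<close> with answers \<open>y\<close>, mark a page whenever it is requested with
  \<open>y = 1\<close>, unmark it when it is requested with \<open>y = 0\<close>, and on a fault with full cache evict a marked
  page. If no cached page is marked, mark the whole cache first. At such a moment the \<open>t\<close> cached pages
  and the requested page do not all fit into the cache of LFD, so some cached page was discarded by LFD
  after its last request \<open>j\<close>, where \<open>x\<^sub>j = 1\<close> and \<open>y\<^sub>j = 0\<close>; the cost \<open>t\<close> that \<open>ASG\<close> pays for \<open>j\<close>
  covers the \<open>t\<close> new marks. Hence the number of faults is at most the \<open>ASG\<close> cost plus \<open>t\<close>.
  Conversely, the optimal \<open>ASG\<close> cost is at most the number of ones in \<open>x\<close>, which is at most the number of
  faults of LFD, and LFD is optimal.\<close>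

section \<open>Counting indices below a bound\<close>

lemma card_Collect_less_Suc:
  "card {j. j < Suc i \<and> P j} = card {j. j < i \<and> P j} + of_bool (P i)"
proof -
  have "{j. j < Suc i \<and> P j} = {j. j < i \<and> P j} \<union> (if P i then {i} else {})"
    by (auto simp: less_Suc_eq)
  then show ?thesis by auto
qed

lemma sum_of_bool_lessThan: "(\<Sum>i<n. of_bool (P i)) = real (card {i. i < n \<and> P i})" for n :: nat
  by (induction n) (simp_all add: card_Collect_less_Suc)

section \<open>Optimality of LFD\<close>

lemma paging_run_legal:
  "paging_run t r a \<Longrightarrow> i < length r \<Longrightarrow> legal_answer t (cache r a i) (r ! i) (a ! i)"
  by (simp add: paging_run_def)

lemma finite_cache: "finite (cache r a i)"
  by (induction i) auto

text \<open>Only a fault with free space changes the size of the cache. This bounds the cache of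
  every run and later supplies the cache-size term in the amortization.\<close>

lemma card_legal_step:
  assumes "legal_answer t C p e" and "finite C" and "card C \<le> t" and "t > 0"
  shows "card (insert p (C - set_option e)) = card C + of_bool (p \<notin> C \<and> card C < t)"
proof (cases "p \<notin> C \<and> card C \<ge> t")
  case True
  with assms obtain q where "q \<in> C" "e = Some q" by (auto simp: legal_answer_def)
  \<comment> \<open>The truncated subtraction is harmless: \<open>card C\<close> is at least
    \<open>t\<close>, hence positive.\<close>
  moreover have "Suc (card C - Suc 0) = card C" using True assms(4) by simp
  ultimately show ?thesis using True assms(2) by (simp add: card_insert_if)
next
  case False
  with assms have "e = None" by (auto simp: legal_answer_def)
  with False assms show ?thesis by (auto simp: card_insert_if)
qed

lemma card_cache_le:
  assumes "paging_run t r a" and "t > 0" and "i \<le> length r"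
  shows "card (cache r a i) \<le> t"
  using assms(3)
proof (induction i)
  case (Suc i)
  then have le: "card (cache r a i) \<le> t" by simp
  from Suc have "i < length r" by simp
  from card_legal_step[OF paging_run_legal[OF assms(1) this] finite_cache le assms(2)] le
  show ?case by (simp add: of_bool_def)
qed simp

lemma cache_subset_requests: "cache r a i \<subseteq> (!) r ` {..<i}"
  by (induction i) auto

lemma next_request_less_iff:
  "next_request r i p < enat d \<longleftrightarrow> (\<exists>k. i < k \<and> k < d \<and> k < length r \<and> r ! k = p)"
  by (auto simp: next_request_def Inf_less_iff)

text \<open>The bound \<open>d\<close> acts as a time horizon; the \<open>min\<close> keeps
  positions inside \<open>r\<close>, so that \<open>d\<close> may be arbitrary.\<close>

definition requested_between :: "'p list \<Rightarrow> nat \<Rightarrow> nat \<Rightarrow> 'p set" where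
  "requested_between r i d = (!) r ` {i..<min d (length r)}"

text \<open>Fault counts alone are not inductive, so cached pages requested before a horizon
  \<open>d\<close> count as credit: the lead of \<open>b\<close> in credit never exceeds its excess
  of faults. The horizon is arbitrary because each step uses the hypothesis at two different
  horizons.\<close>

lemma LFD_run_potential:
  assumes L: "LFD_run t r a" and O: "paging_run t r b" and t: "t > 0" and "i \<le> length r"
  shows "card {j. j < i \<and> r ! j \<notin> cache r a j} + card (cache r b i \<inter> requested_between r i d)
    \<le> card {j. j < i \<and> r ! j \<notin> cache r b j} + card (cache r a i \<inter> requested_between r i d)"
  using \<open>i \<le> length r\<close>
proof (induction i arbitrary: d)
  case 0
  then show ?case by simp
next
  case (Suc i)
  then have i: "i < length r" by simp
  define p where "p = r ! i"
  define A where "A = cache r a i"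
  define B where "B = cache r b i"
  define A' where "A' = cache r a (Suc i)"
  define B' where "B' = cache r b (Suc i)"
  define FA where "FA = card {j. j < i \<and> r ! j \<notin> cache r a j}"
  define FB where "FB = card {j. j < i \<and> r ! j \<notin> cache r b j}"
  define N where "N = requested_between r (Suc i) d"
  have fin: "finite A" "finite B" "finite A'" "finite B'"
    by (simp_all only: A_def B_def A'_def B'_def finite_cache)
  have A': "A' = insert p (A - set_option (a ! i))" and B': "B' = insert p (B - set_option (b ! i))"
    by (simp_all add: A_def B_def A'_def B'_def p_def)
  have La: "paging_run t r a" using L by (simp add: LFD_run_def)
  have IH: "FA + card (B \<inter> requested_between r i d) \<le> FB + card (A \<inter> requested_between r i d)" for d
    using Suc.IH[of d] i by (simp add: FA_def FB_def A_def B_def)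
  have split: "card (X \<inter> insert p Y) = card (X \<inter> Y - {p}) + of_bool (p \<in> X)" if "finite X" for X Y
  proof (cases "p \<in> X")
    case True
    have "card (insert p (X \<inter> Y - {p})) = Suc (card (X \<inter> Y - {p}))"
      using that by (intro card_insert_disjoint) auto
    moreover have "X \<inter> insert p Y = insert p (X \<inter> Y - {p})" using True by blast
    ultimately show ?thesis using True by simp
  qed simp
  have split': "card (X \<inter> Y) = card (X \<inter> Y - {p}) + of_bool (p \<in> Y)" if "finite X" "p \<in> X" for X Y
    using split[OF that(1), of Y] that(2) by (cases "p \<in> Y") (simp_all add: insert_absorb)
  have "{i..<min (Suc i) (length r)} = {i}" using i by auto
  \<comment> \<open>This horizon sees only the current page: if \<open>a\<close> alone faults now,
    then \<open>b\<close> already has an extra fault.\<close>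
  then have "requested_between r i (Suc i) = {p}"
    by (simp only: requested_between_def p_def image_insert image_empty)
  with IH[of "Suc i"] split[OF fin(1), of "{}"] split[OF fin(2), of "{}"]
  have base: "FA + of_bool (p \<in> B) \<le> FB + of_bool (p \<in> A)" by simp
  \<comment> \<open>The maximum keeps request \<open>i\<close> below the horizon even if
    \<open>d \<le> i\<close>, so that \<open>p\<close> can be split off.\<close>
  have "{i..<min (max d (Suc i)) (length r)} = insert i {Suc i..<min d (length r)}" using i by auto
  then have "requested_between r i (max d (Suc i)) = insert p N"
    by (simp only: requested_between_def p_def N_def image_insert)
  with IH[of "max d (Suc i)"] split[OF fin(1), of N] split[OF fin(2), of N]
  have step: "FA + card (B \<inter> N - {p}) + of_bool (p \<in> B) \<le> FB + card (A \<inter> N - {p}) + of_bool (p \<in> A)"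
    by simp
  \<comment> \<open>Both new caches contain \<open>p\<close>, which therefore adds equally to both
    sides and is left out.\<close>
  have main: "FA + of_bool (p \<notin> A) + card (B' \<inter> N - {p}) \<le> FB + of_bool (p \<notin> B) + card (A' \<inter> N - {p})"
  proof (cases "A \<inter> N - {p} \<subseteq> A'")
    case True
    then have "card (A \<inter> N - {p}) \<le> card (A' \<inter> N - {p})"
      by (intro card_mono) (auto simp: fin)
    moreover have "card (B' \<inter> N - {p}) \<le> card (B \<inter> N - {p})"
      by (intro card_mono) (auto simp: fin B')
    ultimately show ?thesis using step by (cases "p \<in> A"; cases "p \<in> B") simp_all
  next
    \<comment> \<open>LFD evicts a page of \<open>N\<close>, so its whole cache lies in \<open>N\<close>.\<close>
    case False
    then obtain q where q: "q \<in> A" "q \<in> N" "a ! i = Some q" unfolding A' by (cases "a ! i") auto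
    then have full: "card A = t" "p \<notin> A"
      using paging_run_legal[OF La i] card_cache_le[OF La t, of i] i
      by (auto simp: legal_answer_def A_def p_def split: if_splits)
    have "next_request r i q < enat d"
      using q(2) by (auto simp: next_request_less_iff N_def requested_between_def Suc_le_eq)
    then have "next_request r i s < enat d" if "s \<in> A" for s
      using L i q(3) that unfolding LFD_run_def A_def by (meson le_less_trans)
    then have "\<exists>k. i < k \<and> k < d \<and> k < length r \<and> r ! k = s" if "s \<in> A" for s
      using that by (simp add: next_request_less_iff)
    then have "A \<subseteq> N" unfolding N_def requested_between_def by fastforce
    with full q have "A' \<inter> N - {p} = A - {q}" unfolding A' by auto
    \<comment> \<open>A cache holding \<open>p\<close> has at most \<open>t - 1\<close> other pages,
      so the credit of LFD is maximal and \<open>base\<close> suffices.\<close>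
    then have A1: "card (A' \<inter> N - {p}) = t - 1" using q full fin by simp
    have "card B' \<le> t" unfolding B'_def using card_cache_le[OF O t, of "Suc i"] i by simp
    moreover have "p \<in> B'" by (simp add: B')
    ultimately have "card (B' - {p}) \<le> t - 1" using fin by simp
    moreover have "card (B' \<inter> N - {p}) \<le> card (B' - {p})"
      by (intro card_mono) (auto simp: fin)
    ultimately show ?thesis using A1 base full(2) by (cases "p \<in> B") simp_all
  qed
  have "p \<in> A'" "p \<in> B'" by (auto simp: A' B')
  with main split'[OF fin(3), of N] split'[OF fin(4), of N] show ?case
    unfolding card_Collect_less_Suc
    by (fold p_def N_def A_def B_def A'_def B'_def FA_def FB_def) simp
qed

lemma LFD_run_optimal:
  assumes "LFD_run t r a" and "paging_run t r b" and "t > 0"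
  shows "faults r a \<le> faults r b"
  \<comment> \<open>At horizon 0 both credits vanish.\<close>
  using LFD_run_potential[OF assms order_refl, of 0]
  by (simp add: faults_def requested_between_def)

section \<open>Discarded requests versus faults of a run\<close>

lemma exists_eviction:
  assumes "p \<in> cache r a i" and "p \<notin> cache r a m" and "i \<le> m"
  shows "\<exists>e. i \<le> e \<and> e < m \<and> a ! e = Some p"
  using assms(3,2)
proof (induction rule: dec_induct)
  case base
  with assms(1) show ?case by simp
next
  case (step m)
  show ?case
  proof (cases "p \<in> cache r a m")
    case True
    with step have "a ! m = Some p" by (cases "a ! m") auto
    with step(1) show ?thesis by blast
  next
    case False
    with step(3) show ?thesis using less_SucI by blast
  qed
qed

lemma not_kept_iff:
  "\<not> kept r a i \<longleftrightarrow> (\<exists>m. i < m \<and> m \<le> length r \<and> (\<forall>l. i < l \<and> l < m \<longrightarrow> r ! l \<noteq> r ! i)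
     \<and> r ! i \<notin> cache r a m)"
  by (auto simp: kept_def)

text \<open>Each discarded request is mapped to an eviction of its page with no request to that page
  in between. Evictions occur only at faults and remove one page each, so the map is injective into
  the faults.\<close>

lemma card_not_kept_le_faults:
  assumes "paging_run t r a"
  shows "card {i. i < length r \<and> \<not> kept r a i} \<le> faults r a"
proof -
  define ev where "ev = (\<lambda>i e. i < e \<and> e < length r \<and> a ! e = Some (r ! i) \<and>
    (\<forall>l. i < l \<and> l < e \<longrightarrow> r ! l \<noteq> r ! i))"
  have "\<exists>e. ev i e" if "i < length r" and "\<not> kept r a i" for i
  proof -
    from that(2) obtain m where m: "i < m" "m \<le> length r"
      "\<forall>l. i < l \<and> l < m \<longrightarrow> r ! l \<noteq> r ! i" "r ! i \<notin> cache r a m"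
      unfolding not_kept_iff by blast
    have "r ! i \<in> cache r a (Suc i)" by simp
    from exists_eviction[OF this m(4)] m(1)
    obtain e where "Suc i \<le> e" "e < m" "a ! e = Some (r ! i)" by auto
    with m show ?thesis unfolding ev_def by (intro exI[of _ e]) auto
  qed
  then obtain e where e: "\<And>i. i < length r \<Longrightarrow> \<not> kept r a i \<Longrightarrow> ev i (e i)" by metis
  have "inj_on e {i. i < length r \<and> \<not> kept r a i}"
  proof (rule inj_onI)
    fix i j
    assume ij: "i \<in> {i. i < length r \<and> \<not> kept r a i}" "j \<in> {i. i < length r \<and> \<not> kept r a i}"
      and eq: "e i = e j"
    from ij have "ev i (e i)" "ev j (e j)" using e by auto
    \<comment> \<open>The evicted page is the same; of two distinct requests to it, the later one
      would lie between the earlier one and the eviction.\<close>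
    then have "r ! i = r ! j" "\<not> i < j" "\<not> j < i" unfolding ev_def eq by auto
    then show "i = j" by simp
  qed
  moreover have "e ` {i. i < length r \<and> \<not> kept r a i} \<subseteq> {i. i < length r \<and> r ! i \<notin> cache r a i}"
  proof safe
    fix i
    assume "i < length r" "\<not> kept r a i"
    from e[OF this] have ev: "e i < length r" "a ! e i = Some (r ! i)" by (auto simp: ev_def)
    then show "e i < length r" by simp
    assume "r ! e i \<in> cache r a (e i)"
    with paging_run_legal[OF assms ev(1)] ev(2) show False by (simp add: legal_answer_def)
  qed
  ultimately show ?thesis unfolding faults_def by (intro card_inj_on_le) auto
qed

section \<open>The marking algorithm\<close>

text \<open>Marking the whole cache is not a separate transition: here and in
  \<open>marking_marks\<close>, an empty \<open>M\<close> is read as \<open>C\<close> at a fault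
  with full cache. \<open>SOME\<close> makes the choice deterministic.\<close>

definition marking_evict :: "nat \<Rightarrow> 'p set \<times> 'p set \<Rightarrow> 'p \<Rightarrow> 'p option" where
  "marking_evict t = (\<lambda>(C, M) p.
     if p \<notin> C \<and> card C \<ge> t then Some (SOME q. q \<in> (if M = {} then C else M)) else None)"

definition marking_marks :: "nat \<Rightarrow> 'p set \<times> 'p set \<Rightarrow> 'p \<Rightarrow> bool \<Rightarrow> 'p set" where
  "marking_marks t = (\<lambda>(C, M) p y.
     ((if p \<notin> C \<and> card C \<ge> t \<and> M = {} then C else M) - set_option (marking_evict t (C, M) p) - {p})
     \<union> (if y then {p} else {}))"

text \<open>The state is the pair of the cache and the set of marked pages.\<close>

primrec marking_state ::
  "nat \<Rightarrow> (nat \<Rightarrow> 'p) \<Rightarrow> (nat \<Rightarrow> bool) \<Rightarrow> nat \<Rightarrow> 'p set \<times> 'p set" where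
  "marking_state t r y 0 = ({}, {})"
| "marking_state t r y (Suc i) =
     (insert (r i) (fst (marking_state t r y i) - set_option (marking_evict t (marking_state t r y i) (r i))),
      marking_marks t (marking_state t r y i) (r i) (y i))"

text \<open>An online algorithm has no memory here, so the state is recomputed from the history:
  \<open>A\<close> is rerun on all prefixes with the pages replaced by prompts. The last entry of
  \<open>h\<close> is the current request.\<close>

definition marking_alg :: "nat \<Rightarrow> (unit, bool) online_alg \<Rightarrow> ('p, 'p option) online_alg" where
  "marking_alg t A h =
     (let r = \<lambda>j. fst (h ! j); y = \<lambda>j. A (take (Suc j) (map (\<lambda>(_, b). ((), b)) h));
          i = length h - 1
      in marking_evict t (marking_state t r y i) (r i))"

lemma marking_state_cong:
  assumes "\<And>j. j < i \<Longrightarrow> r j = r' j" and "\<And>j. j < i \<Longrightarrow> y j = y' j"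
  shows "marking_state t r y i = marking_state t r' y' i"
  using assms by (induction i) simp_all

lemma marking_state_subset:
  "snd (marking_state t r y i) \<subseteq> fst (marking_state t r y i)"
  by (induction i) (auto simp: marking_marks_def split: prod.splits if_splits)

text \<open>A mark is lost only by eviction or by a new request to the page. Hence, when no cached
  page is marked, each of them was last requested with answer 0.\<close>

lemma marked_if_last_answer:
  assumes "y j" and "j < k" and "\<forall>l. j < l \<and> l < k \<longrightarrow> r l \<noteq> r j"
    and "r j \<in> fst (marking_state t r y k)"
  shows "r j \<in> snd (marking_state t r y k)"
  using Suc_leI[OF assms(2)] assms(3,4)
proof (induction rule: dec_induct)
  case base
  then show ?case using assms(1) by (simp add: marking_marks_def split_beta)
next
  case (step m)
  let ?S = "marking_state t r y m"
  have ne: "r j \<noteq> r m" using step.hyps(1) step.prems(1) by (metis Suc_le_eq lessI)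
  with step.prems(2) have "r j \<in> fst ?S" "r j \<notin> set_option (marking_evict t ?S (r m))" by auto
  moreover from this(1) have "r j \<in> snd ?S" using step.IH step.prems(1) by simp
  ultimately show ?case using ne by (simp add: marking_marks_def split_beta)
qed

lemma marking_evict_full:
  assumes "p \<notin> C" and "card C \<ge> t" and "t > 0"
  shows "\<exists>q\<in>(if M = {} then C else M). marking_evict t (C, M) p = Some q"
proof -
  let ?X = "if M = {} then C else M"
  have "?X \<noteq> {}" using assms by auto
  then have "(SOME q. q \<in> ?X) \<in> ?X" by (simp only: some_in_eq not_False_eq_True)
  moreover have "marking_evict t (C, M) p = Some (SOME q. q \<in> ?X)"
    using assms(1,2) by (simp add: marking_evict_def)
  ultimately show ?thesis by (rule rev_bexI)
qed

lemma marking_evict_legal: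
  assumes "t > 0" and "M \<subseteq> C"
  shows "legal_answer t C p (marking_evict t (C, M) p)"
proof (cases "p \<notin> C \<and> card C \<ge> t")
  case True
  with assms(1) obtain q where "marking_evict t (C, M) p = Some q" "q \<in> (if M = {} then C else M)"
    using marking_evict_full[of p C t M] by blast
  with True assms(2) show ?thesis by (auto simp: legal_answer_def split: if_splits)
next
  case False
  then show ?thesis by (auto simp: legal_answer_def marking_evict_def)
qed

text \<open>The answers recomputed from a prefix agree with those of \<open>A\<close> on the whole
  prompt sequence. \<open>x'\<close> is free because answers do not depend on the true bits.\<close>

lemma answers_marking_alg_nth:
  assumes "length xh = length r" and "i < length r"
  shows "answers (marking_alg t A) (x, xh, r) ! i =
    marking_evict t
      (marking_state t ((!) r) ((!) (answers A (x', xh, replicate (length r) ()))) i) (r ! i)"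
proof -
  let ?h = "take (Suc i) (zip r xh)"
  have "map (\<lambda>(_, b). ((), b)) ?h = take (Suc i) (zip (replicate (length r) ()) xh)"
    using assms by (intro nth_equalityI) (simp_all add: split_beta)
  moreover have "length ?h = Suc i" using assms by simp
  ultimately have "marking_alg t A ?h = marking_evict t (marking_state t (\<lambda>j. fst (?h ! j))
      (\<lambda>j. A (take (Suc j) (take (Suc i) (zip (replicate (length r) ()) xh)))) i) (r ! i)"
    using assms by (simp add: marking_alg_def)
  also have "\<dots> = marking_evict t
      (marking_state t ((!) r) ((!) (answers A (x', xh, replicate (length r) ()))) i) (r ! i)"
    by (rule arg_cong[where f = "\<lambda>S. marking_evict t S (r ! i)"], rule marking_state_cong)
      (use assms in \<open>simp_all add: answers_def min_def\<close>)
  finally show ?thesis using assms by (simp add: answers_def)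
qed

lemma cache_marking_state:
  assumes "\<And>i. i < n \<Longrightarrow> a ! i = marking_evict t (marking_state t ((!) r) y i) (r ! i)" and "i \<le> n"
  shows "cache r a i = fst (marking_state t ((!) r) y i)"
  using assms(2) by (induction i) (simp_all add: assms(1))

lemma paging_run_marking:
  assumes "length a = length r" and "t > 0"
    and "\<And>i. i < length r \<Longrightarrow> a ! i = marking_evict t (marking_state t ((!) r) y i) (r ! i)"
  shows "paging_run t r a"
  unfolding paging_run_def
proof (intro conjI allI impI)
  fix i
  assume i: "i < length r"
  have "legal_answer t (fst S) p (marking_evict t S p)" if "snd S \<subseteq> fst S" for S and p :: 'a
    using marking_evict_legal[OF assms(2) that] by simp
  from this[OF marking_state_subset] i show "legal_answer t (cache r a i) (r ! i) (a ! i)"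
    by (simp add: assms(3) cache_marking_state[OF assms(3)])
qed (fact assms(1))

text \<open>The requests with \<open>x = 1\<close> and \<open>y = 0\<close> not yet charged: those that are the last request to a
  cached unmarked page.\<close>

definition uncharged ::
  "'p list \<Rightarrow> (nat \<Rightarrow> bool) \<Rightarrow> (nat \<Rightarrow> bool) \<Rightarrow> nat \<Rightarrow> 'p set \<times> 'p set \<Rightarrow> nat set" where
  "uncharged r x y i S = {j. j < i \<and> x j \<and> \<not> y j \<and> r ! j \<in> fst S - snd S \<and>
     (\<forall>l. j < l \<and> l < i \<longrightarrow> r ! l \<noteq> r ! j)}"

text \<open>\<open>C\<close> and \<open>r ! i\<close> make more than \<open>t\<close> pages, so
  \<open>b\<close> lacks one of them after request \<open>i\<close>. It is not \<open>r ! i\<close>,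
  which has just been loaded; the last request to it is the desired \<open>j\<close>.\<close>

lemma exists_discarded:
  assumes b: "paging_run t r b" and "t > 0" and i: "i < length r"
    and C: "finite C" "card C \<ge> t" "r ! i \<notin> C" "C \<subseteq> (!) r ` {..<i}"
  shows "\<exists>j<i. \<not> kept r b j \<and> r ! j \<in> C \<and> (\<forall>l. j < l \<and> l < i \<longrightarrow> r ! l \<noteq> r ! j)"
proof -
  let ?D = "cache r b (Suc i)"
  have "card (insert (r ! i) C) > card ?D"
    using C card_cache_le[OF b \<open>t > 0\<close>, of "Suc i"] i by (simp del: cache.simps)
  then have "\<not> insert (r ! i) C \<subseteq> ?D"
    using card_mono[OF finite_cache, of _ r b "Suc i"] by (meson leD)
  then obtain q where q: "q \<in> C" "q \<notin> ?D" by auto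
  define j where "j = Max {j. j < i \<and> r ! j = q}"
  have "{j. j < i \<and> r ! j = q} \<noteq> {}" using q C(4) by auto
  then have "j \<in> {j. j < i \<and> r ! j = q}" unfolding j_def by (intro Max_in) auto
  then have j: "j < i" "r ! j = q" by auto
  have last: "r ! l \<noteq> r ! j" if "j < l" "l < i" for l
  proof
    assume "r ! l = r ! j"
    with that j have "l \<le> j" unfolding j_def by (intro Max_ge) auto
    with that show False by simp
  qed
  \<comment> \<open>The witness is \<open>Suc i\<close>: request \<open>i\<close> itself is not to
    \<open>q\<close>, since \<open>r ! i\<close> is outside \<open>C\<close>.\<close>
  have "\<not> kept r b j"
    unfolding not_kept_iff using j i q last C(3)
    by (intro exI[of _ "Suc i"]) (auto simp: less_Suc_eq)
  with j q last show ?thesis by blast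
qed

text \<open>An evicting fault is paid by a mark, any other fault by the growth of the cache. An
  answer 1 buys one mark; a wrong answer 0 deposits \<open>t\<close>, which a later marking of the
  whole cache may spend.\<close>

lemma marking_potential:
  assumes b: "paging_run t r b" and t: "t > 0" and len: "length a = length r"
    and a: "\<And>i. i < length r \<Longrightarrow> a ! i = marking_evict t (marking_state t ((!) r) y i) (r ! i)"
    and x: "\<And>i. i < length r \<Longrightarrow> x i \<longleftrightarrow> \<not> kept r b i"
    and "i \<le> length r"
  defines "S \<equiv> marking_state t ((!) r) y"
  shows "card {j. j < i \<and> r ! j \<notin> cache r a j} + card (snd (S i)) + t * card (uncharged r x y i (S i))
    \<le> card {j. j < i \<and> y j} + t * card {j. j < i \<and> x j \<and> \<not> y j} + card (fst (S i))"
  using \<open>i \<le> length r\<close>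
proof (induction i)
  case 0
  then show ?case by (simp add: uncharged_def S_def)
next
  case (Suc i)
  then have i: "i < length r" by simp
  note run = paging_run_marking[OF len t a]
  define p where "p = r ! i"
  define C where "C = fst (S i)"
  define M where "M = snd (S i)"
  define C' where "C' = fst (S (Suc i))"
  define M' where "M' = snd (S (Suc i))"
  define e where "e = marking_evict t (C, M) p"
  define Act where "Act = uncharged r x y i (S i)"
  define Act' where "Act' = uncharged r x y (Suc i) (S (Suc i))"
  have cacheC: "cache r a i = C" using cache_marking_state[OF a] i by (simp add: C_def S_def)
  have finC: "finite C" by (metis cacheC finite_cache)
  have MC: "M \<subseteq> C" unfolding M_def C_def S_def by (rule marking_state_subset)
  then have finM: "finite M" using finC by (rule finite_subset)
  have finAct: "finite Act" by (simp add: Act_def uncharged_def)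
  have cardC: "card C \<le> t" using card_cache_le[OF run t, of i] i cacheC by simp
  have C': "C' = insert p (C - set_option e)"
    by (simp add: C'_def C_def S_def p_def e_def M_def)
  have M': "M' = ((if p \<notin> C \<and> card C \<ge> t \<and> M = {} then C else M) - set_option e - {p})
     \<union> (if y i then {p} else {})"
    by (simp add: M'_def C_def S_def p_def e_def M_def marking_marks_def split_beta)
  have cardC': "card C' = card C + of_bool (p \<notin> C \<and> card C < t)"
    unfolding C' e_def by (rule card_legal_step[OF marking_evict_legal[OF t MC] finC cardC t])
  have IH: "card {j. j < i \<and> r ! j \<notin> cache r a j} + card M + t * card Act
    \<le> card {j. j < i \<and> y j} + t * card {j. j < i \<and> x j \<and> \<not> y j} + card C"
    using Suc by (simp add: C_def M_def Act_def)
  \<comment> \<open>Request \<open>i\<close> supersedes all earlier requests to \<open>p\<close>, so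
    \<open>i\<close> is the only possible newcomer.\<close>
  have Act'_sub: "Act' \<subseteq> {j. j < i \<and> x j \<and> \<not> y j \<and> r ! j \<in> C' - M' \<and> r ! j \<noteq> p \<and>
      (\<forall>l. j < l \<and> l < i \<longrightarrow> r ! l \<noteq> r ! j)} \<union> (if x i \<and> \<not> y i then {i} else {})"
    unfolding Act'_def uncharged_def C'_def M'_def p_def by (auto simp: less_Suc_eq)
  \<comment> \<open>The change of the potential in one step, with all terms moved so that no
    subtraction of naturals occurs.\<close>
  have "of_bool (p \<notin> C) + card M' + t * card Act' + card C
    \<le> card M + t * card Act + of_bool (y i) + t * of_bool (x i \<and> \<not> y i) + card C'"
  proof (cases "p \<notin> C \<and> card C \<ge> t \<and> M = {}")
    case flush: True
    then obtain q where q: "e = Some q" "q \<in> C"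
      using marking_evict_full[of p C t M] t unfolding e_def by auto
    have "card M' \<le> card (C - {q}) + card (if y i then {p} else {})"
      unfolding M' using flush q
      by (intro order_trans[OF card_Un_le] add_mono card_mono) (auto simp: finC)
    also have "\<dots> = t - 1 + of_bool (y i)" using q flush cardC finC by simp
    finally have 1: "card M' \<le> t - 1 + of_bool (y i)" .
    \<comment> \<open>After marking everything, all cached pages other than \<open>p\<close> are
      marked, so every old deposit is released.\<close>
    have "Act' \<subseteq> (if x i \<and> \<not> y i then {i} else {})"
      using Act'_sub flush unfolding C' M' by auto
    from card_mono[OF _ this] have 2: "card Act' \<le> of_bool (x i \<and> \<not> y i)"
      by (auto split: if_splits)
    have "C \<subseteq> (!) r ` {..<i}" using cache_subset_requests[of r a i] cacheC by simp
    then have "\<exists>j<i. \<not> kept r b j \<and> r ! j \<in> C \<and> (\<forall>l. j < l \<and> l < i \<longrightarrow> r ! l \<noteq> r ! j)"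
      using flush by (intro exists_discarded[OF b t i finC]) (auto simp: p_def)
    then obtain j where j: "j < i" "\<not> kept r b j" "r ! j \<in> C"
      "\<forall>l. j < l \<and> l < i \<longrightarrow> r ! l \<noteq> r ! j" by blast
    have "\<not> y j"
    proof
      assume "y j"
      from marked_if_last_answer[where r = "(!) r" and y = y and t = t, OF this j(1)] j(3,4)
      have "r ! j \<in> M" by (simp add: C_def M_def S_def)
      with flush show False by simp
    qed
    moreover have "x j" using j(1,2) i x by simp
    ultimately have "j \<in> Act" using j flush by (simp add: Act_def uncharged_def C_def M_def)
    \<comment> \<open>One released deposit of \<open>t\<close> pays for the \<open>t\<close> new
      marks, one of which is spent at once on the evicted page.\<close>
    then have "card Act \<ge> 1" using finAct by (simp add: Suc_le_eq card_gt_0_iff) blast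
    then have "t \<le> t * card Act" by simp
    moreover have "t * card Act' \<le> t * of_bool (x i \<and> \<not> y i)" using 2 by (rule mult_le_mono2)
    moreover have "of_bool (p \<notin> C) = (1 :: nat)" "card C' = card C" using flush cardC' by auto
    ultimately show ?thesis using 1 t by linarith
  next
    case False
    then have M'2: "M' = (M - set_option e - {p}) \<union> (if y i then {p} else {})" unfolding M' by auto
    have "Act' \<subseteq> Act \<union> (if x i \<and> \<not> y i then {i} else {})"
      using Act'_sub unfolding Act_def uncharged_def
      by (fold C_def M_def) (auto simp: C' M'2)
    then have "card Act' \<le> card (Act \<union> (if x i \<and> \<not> y i then {i} else {}))"
      using finAct by (intro card_mono) auto
    also have "\<dots> \<le> card Act + of_bool (x i \<and> \<not> y i)"
      by (rule order_trans[OF card_Un_le]) simp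
    finally have 2: "t * card Act' \<le> t * card Act + t * of_bool (x i \<and> \<not> y i)"
      by (metis add_mult_distrib2 mult_le_mono2)
    have 3: "card M' \<le> card (M - set_option e) + of_bool (y i)"
    proof -
      have "card M' \<le> card (M - set_option e - {p}) + card (if y i then {p} else {})"
        unfolding M'2 by (rule card_Un_le)
      also have "card (M - set_option e - {p}) \<le> card (M - set_option e)"
        using finM by (intro card_mono) auto
      finally show ?thesis by (cases "y i") simp_all
    qed
    have "of_bool (p \<notin> C \<and> card C \<ge> t) + card (M - set_option e) \<le> card M"
    proof (cases "p \<notin> C \<and> card C \<ge> t")
      case True
      with False obtain q where "e = Some q" "q \<in> M"
        using marking_evict_full[of p C t M] t unfolding e_def by auto
      moreover from this(2) have "card (M - {q}) < card M" by (rule card_Diff1_less[OF finM])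
      ultimately show ?thesis using True by simp
    next
      case False
      then show ?thesis using finM by (auto intro: card_mono)
    qed
    \<comment> \<open>Faults are split into those that evict, paid by a mark, and those that fill
      free space, paid by \<open>cardC'\<close>.\<close>
    moreover have "of_bool (p \<notin> C) = of_bool (p \<notin> C \<and> card C \<ge> t) + (of_bool (p \<notin> C \<and> card C < t) :: nat)"
      by (cases "card C \<ge> t") simp_all
    ultimately show ?thesis using 2 3 cardC' by linarith
  qed
  with IH show ?case
    unfolding card_Collect_less_Suc cacheC add_mult_distrib2
    by (fold p_def C'_def M'_def Act'_def) linarith
qed

text \<open>The additive \<open>t\<close> bounds the cache-size term of the potential at the
  end.\<close>

lemma faults_marking_le:
  assumes "paging_run t r b" and "t > 0" and "length a = length r"
    and "\<And>i. i < length r \<Longrightarrow> a ! i = marking_evict t (marking_state t ((!) r) y i) (r ! i)"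
    and "\<And>i. i < length r \<Longrightarrow> x i \<longleftrightarrow> \<not> kept r b i"
  shows "faults r a \<le>
    card {j. j < length r \<and> y j} + t * card {j. j < length r \<and> x j \<and> \<not> y j} + t"
proof -
  have "card (fst (marking_state t ((!) r) y (length r))) \<le> t"
    using card_cache_le[OF paging_run_marking[OF assms(3,2,4)] assms(2), of "length r"]
      cache_marking_state[OF assms(4), of "length r"] by simp
  with marking_potential[OF assms order_refl] show ?thesis by (simp add: faults_def)
qed

section \<open>The reduction\<close>

lemma ASG_cost_eq:
  "cost (ASG t) (x, xh, r) y =
    real (card {j. j < length r \<and> y ! j} + t * card {j. j < length r \<and> x ! j \<and> \<not> y ! j})"
proof -
  have "cost (ASG t) (x, xh, r) y =
    (\<Sum>j<length r. of_bool (y ! j)) + real t * (\<Sum>j<length r. of_bool (x ! j \<and> \<not> y ! j))"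
    unfolding sum_distrib_left sum.distrib[symmetric]
    by (auto simp: ASG_def intro!: sum.cong)
  then show ?thesis by (simp add: sum_of_bool_lessThan)
qed

lemma Opt_ASG_nonneg:
  assumes "(x, xh, r) \<in> instances (ASG t)"
  shows "0 \<le> Opt (ASG t) (x, xh, r)"
  unfolding Opt_def
proof (rule cInf_greatest)
  show "{cost (ASG t) (x, xh, r) ys |ys. feasible (ASG t) (x, xh, r) ys} \<noteq> {}"
    using assms by (auto simp: ASG_def)
qed (auto simp: ASG_cost_eq)

text \<open>Answering with \<open>x\<close> itself costs 1 per true one and misses none.\<close>

lemma Opt_ASG_le:
  assumes "(x, xh, r) \<in> instances (ASG t)"
  shows "Opt (ASG t) (x, xh, r) \<le> card {j. j < length r \<and> x ! j}"
proof -
  have "Opt (ASG t) (x, xh, r) \<le> cost (ASG t) (x, xh, r) x"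
    unfolding Opt_def
  proof (rule cInf_lower)
    show "bdd_below {cost (ASG t) (x, xh, r) ys |ys. feasible (ASG t) (x, xh, r) ys}"
      by (rule bdd_belowI[of _ 0]) (auto simp: ASG_cost_eq)
  qed (use assms in \<open>auto simp: ASG_def\<close>)
  then show ?thesis by (simp add: ASG_cost_eq)
qed

text \<open>Needed to multiply the comparison of optima by \<open>\<alpha>\<close>. On
  \<open>n\<close> ones predicted correctly both errors vanish and every answer costs at least
  \<open>n\<close>; a negative \<open>\<alpha>\<close> would bound this by
  \<open>\<kappa>\<close>.\<close>

lemma competitive_ASG_nonneg:
  assumes "competitive (ASG t) \<alpha> \<beta> \<gamma> A" and "t > 0"
  shows "\<alpha> \<ge> 0"
proof (rule ccontr)
  assume neg: "\<not> \<alpha> \<ge> 0"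
  from assms(1) obtain \<kappa> where \<kappa>: "\<And>I. I \<in> instances (ASG t) \<Longrightarrow>
      cost (ASG t) I (answers A I) \<le> \<alpha> * Opt (ASG t) I + \<beta> * mu0 I + \<gamma> * mu1 I + \<kappa>"
    unfolding competitive_def by blast
  obtain n :: nat where n: "\<kappa> < real n" using reals_Archimedean2 by blast
  define I where "I = (replicate n True, replicate n True, replicate n ())"
  have inst: "I \<in> instances (ASG t)" by (simp add: I_def ASG_def)
  have "mu0 I = 0" "mu1 I = 0" by (simp_all add: I_def mu0_def mu1_def)
  moreover have "\<alpha> * Opt (ASG t) I \<le> 0"
    using neg Opt_ASG_nonneg inst unfolding I_def by (intro mult_nonpos_nonneg) auto
  ultimately have "cost (ASG t) I (answers A I) \<le> \<kappa>" using \<kappa>[OF inst] by simp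
  moreover have "real n \<le> cost (ASG t) I (answers A I)"
  proof -
    define y where "y = answers A I"
    have "n = card ({j. j < n \<and> y ! j} \<union> {j. j < n \<and> \<not> y ! j})"
      by (subst card_lessThan[of n, symmetric]) (rule arg_cong[of _ _ card], auto)
    also have "\<dots> \<le> card {j. j < n \<and> y ! j} + 1 * card {j. j < n \<and> \<not> y ! j}"
      using card_Un_le by simp
    also have "\<dots> \<le> card {j. j < n \<and> y ! j} + t * card {j. j < n \<and> \<not> y ! j}"
      using assms(2) by (intro add_left_mono mult_le_mono1) simp
    also have "{j. j < n \<and> \<not> y ! j} = {j. j < n \<and> replicate n True ! j \<and> \<not> y ! j}" by auto
    finally show ?thesis
      unfolding y_def[symmetric] unfolding I_def ASG_cost_eq by (simp only: length_replicate of_nat_le_iff)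
  qed
  ultimately show False using n by simp
qed

text \<open>Discards of LFD are at most its faults, which are at most the faults of any run, so the
  bound passes to the infimum.\<close>

lemma card_discard_le_Opt_PAG:
  assumes "t > 0" and "LFD_run t r (lfd r)"
  shows "real (card {j. j < length r \<and> \<not> kept r (lfd r) j}) \<le> Opt (PAG t U lfd) (x, xh, r)"
  unfolding Opt_def
proof (rule cInf_greatest)
  have run: "paging_run t r (lfd r)" using assms(2) by (simp add: LFD_run_def)
  then show "{cost (PAG t U lfd) (x, xh, r) ys |ys. feasible (PAG t U lfd) (x, xh, r) ys} \<noteq> {}"
    by (auto simp: PAG_def)
  fix c
  assume "c \<in> {cost (PAG t U lfd) (x, xh, r) ys |ys. feasible (PAG t U lfd) (x, xh, r) ys}"
  then obtain b where b: "paging_run t r b" "c = real (faults r b)" by (auto simp: PAG_def)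
  have "card {j. j < length r \<and> \<not> kept r (lfd r) j} \<le> faults r (lfd r)"
    by (rule card_not_kept_le_faults[OF run])
  also have "\<dots> \<le> faults r b" by (rule LFD_run_optimal[OF assms(2) b(1) assms(1)])
  finally show "real (card {j. j < length r \<and> \<not> kept r (lfd r) j}) \<le> c" by (simp add: b(2))
qed

lemma competitive_marking_alg:
  assumes t: "t > 0" and lfd: "is_LFD t U lfd" and A: "competitive (ASG t) \<alpha> \<beta> \<gamma> A"
  shows "competitive (PAG t U lfd) \<alpha> \<beta> \<gamma> (marking_alg t A)"
proof -
  from A obtain \<kappa> where \<kappa>: "\<And>I. I \<in> instances (ASG t) \<Longrightarrow>
      cost (ASG t) I (answers A I) \<le> \<alpha> * Opt (ASG t) I + \<beta> * mu0 I + \<gamma> * mu1 I + \<kappa>"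
    unfolding competitive_def by blast
  have main: "feasible (PAG t U lfd) I (answers (marking_alg t A) I) \<and>
    cost (PAG t U lfd) I (answers (marking_alg t A) I)
      \<le> \<alpha> * Opt (PAG t U lfd) I + \<beta> * mu0 I + \<gamma> * mu1 I + (\<kappa> + real t)"
    if "I \<in> instances (PAG t U lfd)" for I
  proof -
    obtain x xh r where I: "I = (x, xh, r)" by (cases I)
    with that have r: "set r \<subseteq> U" and xh: "length xh = length r" and x: "x = discard_bits r (lfd r)"
      by (auto simp: PAG_def)
    have L: "LFD_run t r (lfd r)" using lfd r by (simp add: is_LFD_def)
    then have b: "paging_run t r (lfd r)" by (simp add: LFD_run_def)
    \<comment> \<open>\<open>J\<close> keeps both bit strings of \<open>I\<close>, so the error
      measures agree and \<open>\<beta>\<close>, \<open>\<gamma>\<close> may have any sign.\<close>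
    define J where "J = (x, xh, replicate (length r) ())"
    define y where "y = answers A J"
    define a where "a = answers (marking_alg t A) I"
    have len: "length a = length r" by (simp add: a_def I answers_def)
    have a: "a ! i = marking_evict t (marking_state t ((!) r) ((!) y) i) (r ! i)" if "i < length r" for i
      unfolding a_def I y_def J_def by (rule answers_marking_alg_nth[OF xh that])
    have xi: "x ! i \<longleftrightarrow> \<not> kept r (lfd r) i" if "i < length r" for i
      using that by (simp add: x discard_bits_def)
    have J: "J \<in> instances (ASG t)" by (simp add: J_def ASG_def xh x discard_bits_def)
    have "real (faults r a) \<le> cost (ASG t) J y + real t"
      using faults_marking_le[OF b t len a xi] unfolding J_def ASG_cost_eq length_replicate
      by (simp only: of_nat_add[symmetric] of_nat_le_iff)
    also have "\<dots> \<le> \<alpha> * Opt (ASG t) J + \<beta> * mu0 J + \<gamma> * mu1 J + \<kappa> + real t"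
      using \<kappa>[OF J] by (simp add: y_def)
    also have "Opt (ASG t) J \<le> Opt (PAG t U lfd) I"
    proof -
      have "Opt (ASG t) J \<le> real (card {j. j < length r \<and> x ! j})"
        using Opt_ASG_le J unfolding J_def by fastforce
      also have "{j. j < length r \<and> x ! j} = {j. j < length r \<and> \<not> kept r (lfd r) j}"
        using xi by auto
      also have "real (card \<dots>) \<le> Opt (PAG t U lfd) I"
        unfolding I by (rule card_discard_le_Opt_PAG[where lfd = lfd, OF t L])
      finally show ?thesis .
    qed
    then have "\<alpha> * Opt (ASG t) J \<le> \<alpha> * Opt (PAG t U lfd) I"
      using competitive_ASG_nonneg[OF A t] by (rule mult_left_mono)
    finally have "real (faults r a) \<le> \<alpha> * Opt (PAG t U lfd) I + \<beta> * mu0 J + \<gamma> * mu1 J + \<kappa> + real t"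
      by simp
    moreover have "mu0 J = mu0 I" "mu1 J = mu1 I" by (simp_all add: I J_def mu0_def mu1_def)
    ultimately show ?thesis
      using paging_run_marking[OF len t a] unfolding a_def[symmetric] by (simp add: I PAG_def)
  qed
  then show ?thesis unfolding competitive_def by blast
qed

theorem theorem57:
  fixes t :: nat and U :: "'p set" and lfd :: "'p list \<Rightarrow> 'p option list"
  assumes "t > 0"
    and "finite U" and "card U > t"
    and "is_LFD t U lfd"
  shows "PAG t U lfd \<in> complexity_class t"
  unfolding complexity_class_def as_hard_as_def
  using competitive_marking_alg[OF assms(1,4)] by blast

end
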